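(* Let $n$ be an integer with $n>1$. In all statements below, solutions are meant in positive integers $x,y,z,w$. The following hold. (i) Assume that $n \equiv 4 \pmod{16}$ or $n \equiv 8 \pmod{16}$ or $n \equiv 1 \pmod{8}$ or $n \equiv 2 \pmod{8}$. Then the equation $n^x+(n+1)^y+(n+2)^z=(n+3)^w$ has no solution. (ii) Assume that $n \equiv 4 \pmod{8}$ or $n \equiv 1 \pmod{4}$ or $n \equiv 2 \pmod{8}$ or $n \equiv 3 \pmod{8}$. Then the equation $n^x+(n+1)^y=(n+2)^z+(n+3)^w$ has no solution, except for $n=2$ or $n=3$, where all solutions are given by $(x,y,z,w)=(1,3,1,2),(3,4,3,2),(5,2,2,2)$ for $n=2$, and by $(x,y,z,w)=(3,1,2,1)$ for $n=3$. (iii) Assume that $n \equiv 8 \pmod{16}$ or $n \equiv 12 \pmod{16}$ or $n \equiv 5 \pmod{8}$ or $n \equiv 2 \pmod{4}$ or $n \equiv 3 \pmod{8}$. Then the equation $n^x+(n+2)^z+(n+3)^w=(n+1)^y$ has no solution, except for $n=3$, where the only solution is given by $(x,y,z,w)=(1,3,2,2)$. (iv) Assume that $n \equiv 4 \pmod{16}$ or $n \equiv 8 \pmod{16}$ or $n \equiv 1 \pmod{8}$ or $n \equiv 2 \pmod{8}$ or $n \equiv 3 \pmod{8}$. Then the equation $n^x+(n+2)^z=(n+1)^y+(n+3)^w$ has no solution, except for $n=2$ or $n=3$, where all solutions are given by $(x,y,z,w)=(2,1,1,1),(4,3,2,1),(6,1,3,3)$ for $n=2$, and by $(x,y,z,w)=(3,2,2,2)$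 for $n=3$. *)

theory Defs
  imports "HOL-Number_Theory.Number_Theory"
begin

end

theory Submission
  imports Defs "HOL-Library.Code_Binary_Nat"
begin

text \<open>
The theorem combines a uniform argument, which leaves only the bases \<open>n = 2\<close> and \<open>n = 3\<close>,
with a finite search for these two.

For the first part, read the equations modulo \<open>n + 1\<close> and modulo \<open>n + 2\<close>. The four bases turn
into \<open>-1, 0, 1, 2\<close> and \<open>-2, -1, 0, 1\<close>, so that what is left is a divisibility of
\<open>2 ^ k\<close>, \<open>2 ^ k - 2\<close> or \<open>2 ^ k + 2\<close> by \<open>n + 1\<close> or \<open>n + 2\<close>, governed by the parities of \<open>x\<close>
and \<open>y\<close> (lemma \<open>residues_at_neighbours\<close>). In each residue class of the theorem every
combination of parities leads to an impossible one once \<open>n > 3\<close>: a divisor of \<open>2 ^ k\<close> that is not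
a multiple of \<open>8\<close> is at most \<open>4\<close>, and the others contradict divisibility by \<open>4\<close> or make \<open>2\<close>,
\<open>-1\<close> or \<open>-2\<close> a square modulo an odd number whose class modulo \<open>8\<close> rules this out (lemma \<open>no_root_mod_by_descent\<close>).

For \<open>n = 2\<close> and \<open>n = 3\<close> the solutions are isolated, and each equation is solved by
congruences. The exponents are confined to finitely many tuples of arithmetic progressions,
which are refined and tested modulo suitable numbers until essentially only the solutions
survive (theorem \<open>exponent_sieve_complete\<close>). The search is an executable function, evaluated inside
the logic. In three cases a few tuples survive that an estimate or a factorisation of
\<open>17 = 3 ^ y - 4 ^ z\<close> removes.
\<close>

section \<open>Quadratic characters of 2, -1 and -2\<close>

text \<open>Infinite descent replaces quadratic reciprocity for the characters of \<open>2\<close>, \<open>-1\<close>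
and \<open>-2\<close>. If \<open>m\<close> is odd, a root \<open>u\<close> of \<open>u\<^sup>2 - D\<close> modulo \<open>m\<close> can be moved to a root
\<open>v\<close> of prescribed parity with \<open>\<bar>v\<bar> < m\<close>, and then \<open>v\<^sup>2 - D = m k\<close> with \<open>0 < k < m\<close>. The
parity of \<open>v\<close> determines \<open>m k\<close> modulo \<open>8\<close> (or \<open>4\<close>), so \<open>k\<close> lies in a bad residue class
again and has the same root. This works for composite \<open>m\<close> as well, which spares the
choice of a suitable prime factor.\<close>

lemma no_root_mod_by_descent:
  fixes D u m :: int
  assumes D: "D \<noteq> 0" "\<bar>D\<bar> \<le> 2" and odd: "\<forall>r \<in> R. odd r" and one: "1 \<notin> R"
    and descent: "\<And>v m k. even v = e \<Longrightarrow> v\<^sup>2 - D = m * k \<Longrightarrow> m mod 8 \<in> R \<Longrightarrow> k mod 8 \<in> R"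
    and m: "m > 0" "m mod 8 \<in> R"
  shows "\<not> m dvd u\<^sup>2 - D"
  using m
proof (induction "nat m" arbitrary: m u rule: less_induct)
  case less
  show ?case
  proof
    assume dvd: "m dvd u\<^sup>2 - D"
    have "odd (m mod 8)" using less.prems(2) odd by blast
    then have "odd m" by presburger
    have "m \<noteq> 1" using less.prems one by auto
    with \<open>odd m\<close> less.prems(1) have "m \<ge> 3" by presburger
    define r where "r = u mod m"
    \<comment> \<open>as \<open>m\<close> is odd, exactly one of \<open>r\<close> and \<open>r - m\<close> has the wanted parity\<close>
    define v where "v = (if even r = e then r else r - m)"
    have "0 \<le> r" "r < m" using less.prems(1) by (simp_all add: r_def)
    have "[r = u] (mod m)" by (simp add: r_def)
    then have "[v = u] (mod m)" by (auto simp: v_def cong_def)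
    then have "[v\<^sup>2 - D = u\<^sup>2 - D] (mod m)" by (intro cong_diff cong_pow cong_refl)
    with dvd have "m dvd v\<^sup>2 - D" by (simp add: cong_dvd_iff)
    moreover have "r \<noteq> 0"
    proof
      assume "r = 0"
      then have "m dvd u\<^sup>2" by (simp add: r_def power2_eq_square mod_eq_0_iff_dvd)
      with dvd have "m dvd D" using dvd_diff[of m "u\<^sup>2" "u\<^sup>2 - D"] by simp
      with D \<open>m \<ge> 3\<close> show False using dvd_imp_le_int[of D m] by auto
    qed
    with \<open>0 \<le> r\<close> \<open>r < m\<close> have "\<bar>v\<bar> < m" by (auto simp: v_def)
    moreover have "even v = e" using \<open>odd m\<close> by (auto simp: v_def)
    ultimately have v: "\<bar>v\<bar> < m" "m dvd v\<^sup>2 - D" "even v = e" by auto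
    then obtain k where k: "v\<^sup>2 - D = m * k" by (elim dvdE)
    have "k mod 8 \<in> R" using descent v k less.prems by blast
    then have "k \<noteq> 0" using odd by auto
    have "v\<^sup>2 \<le> (m - 1)\<^sup>2"
      using v(1) by (intro abs_le_square_iff[THEN iffD1]) auto
    also have "(m - 1)\<^sup>2 = m * m - 2 * m + 1" by (simp add: power2_eq_square algebra_simps)
    finally have "m * k < m * m" using k D \<open>m \<ge> 3\<close> by linarith
    then have "k < m" using \<open>m \<ge> 3\<close> by simp
    have "- m < m * k" using k D \<open>m \<ge> 3\<close> zero_le_power2[of v] by linarith
    then have "m * (-1) < m * k" by simp
    then have "k > -1" using \<open>m \<ge> 3\<close> by (simp only: mult_less_cancel_left_pos)
    with \<open>k \<noteq> 0\<close> have "k > 0" by simp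
    have "k dvd v\<^sup>2 - D" using k by simp
    with less.hyps[of k v] \<open>k > 0\<close> \<open>k < m\<close> \<open>k mod 8 \<in> R\<close> show False by simp
  qed
qed

lemma square_mod_8:
  fixes v :: int
  assumes "odd v"
  shows "v\<^sup>2 mod 8 = 1"
proof -
  have "v mod 8 \<in> {1, 3, 5, 7}" using assms by simp presburger
  then have "(v mod 8)\<^sup>2 mod 8 = 1" by auto
  then show ?thesis by (simp add: power_mod)
qed

lemma square_mod_4:
  fixes v :: int
  assumes "even v"
  shows "v\<^sup>2 mod 4 = 0"
  using assms by (auto simp: power2_eq_square elim!: evenE)

lemma cofactor_mod_8:
  fixes m k a :: int
  assumes "m * k mod 8 = a"
  shows "(m mod 8) * (k mod 8) mod 8 = a \<and> k mod 8 \<in> {0, 1, 2, 3, 4, 5, 6, 7}"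
proof -
  have "k mod 8 \<in> {0, 1, 2, 3, 4, 5, 6, 7}" by simp presburger
  with assms show ?thesis by (simp add: mod_mult_eq)
qed

lemma two_not_square_mod:
  fixes u m :: int
  assumes "m > 0" "m mod 8 \<in> {3, 5}"
  shows "\<not> m dvd u\<^sup>2 - 2"
proof (rule no_root_mod_by_descent[where R = "{3, 5}" and e = False])
  fix v m k :: int
  assume "even v = False" and eq: "v\<^sup>2 - 2 = m * k" and m: "m mod 8 \<in> {3, 5}"
  have "w mod 8 = 1 \<Longrightarrow> (w - 2) mod 8 = 7" for w :: int by presburger
  with square_mod_8[of v] \<open>even v = False\<close> have "m * k mod 8 = 7" by (simp flip: eq)
  from cofactor_mod_8[OF this] m show "k mod 8 \<in> {3, 5}" by auto
qed (use assms in auto)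

lemma minus_two_not_square_mod:
  fixes u m :: int
  assumes "m > 0" "m mod 8 \<in> {5, 7}"
  shows "\<not> m dvd u\<^sup>2 + 2"
proof -
  have "\<not> m dvd u\<^sup>2 - (-2)"
  proof (rule no_root_mod_by_descent[where R = "{5, 7}" and e = False])
    fix v m k :: int
    assume "even v = False" and eq: "v\<^sup>2 - (-2) = m * k" and m: "m mod 8 \<in> {5, 7}"
    have "w mod 8 = 1 \<Longrightarrow> (w - (-2)) mod 8 = 3" for w :: int by presburger
    with square_mod_8[of v] \<open>even v = False\<close> have "m * k mod 8 = 3" by (simp flip: eq)
    from cofactor_mod_8[OF this] m show "k mod 8 \<in> {5, 7}" by auto
  qed (use assms in auto)
  then show ?thesis by simp
qed

lemma minus_one_not_square_mod:
  fixes u m :: int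
  assumes "m > 0" "m mod 4 = 3"
  shows "\<not> m dvd u\<^sup>2 + 1"
proof -
  have "\<not> m dvd u\<^sup>2 - (-1)"
  proof (rule no_root_mod_by_descent[where R = "{3, 7}" and e = True])
    fix v m k :: int
    assume "even v = True" and eq: "v\<^sup>2 - (-1) = m * k" and m: "m mod 8 \<in> {3, 7}"
    have "w mod 4 = 0 \<Longrightarrow> (w - (-1)) mod 8 = 1 \<or> (w - (-1)) mod 8 = 5" for w :: int by presburger
    with square_mod_4[of v] \<open>even v = True\<close> have "m * k mod 8 = 1 \<or> m * k mod 8 = 5" by (simp flip: eq)
    then show "k mod 8 \<in> {3, 7}"
      using m by (elim disjE) (drule cofactor_mod_8, auto)+
  next
    show "m mod 8 \<in> {3, 7}" using assms(2) by simp presburger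
  qed (use assms in auto)
  then show ?thesis by simp
qed

text \<open>In the residue classes of the theorem \<open>n + 1\<close> is never a multiple of \<open>8\<close>, and \<open>n + 2\<close> is
one only if \<open>n \<equiv> 6 (mod 8)\<close>. Otherwise either of them dividing a power of two is at most \<open>4\<close>,
so that \<open>n\<close> is \<open>2\<close> or \<open>3\<close>.\<close>

lemma divisor_of_power_of_two:
  fixes d :: int
  assumes "d > 0" "d dvd 2 ^ k" "d mod 8 \<noteq> 0"
  shows "d \<in> {1, 2, 4}"
proof -
  have "nat d dvd 2 ^ k" using assms(1,2) by (simp add: nat_dvd_iff)
  then obtain j where "nat d = 2 ^ j" by (auto simp: divides_primepow_nat)
  then have d: "d = 2 ^ j" using assms(1) by (simp add: nat_eq_iff)
  have "j < 3"
  proof (rule ccontr)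
    assume "\<not> j < 3"
    then have "(2::int) ^ 3 dvd d" unfolding d by (intro le_imp_power_dvd) simp
    with assms(3) show False by (simp add: dvd_eq_mod_eq_0)
  qed
  then have "j = 0 \<or> j = 1 \<or> j = 2" by auto
  then show ?thesis by (auto simp: d)
qed

section \<open>Reduction to the bases 2 and 3\<close>

text \<open>With \<open>x\<close> even, \<open>2 ^ x\<close> is a square, so the residue classes of the quadratic characters
apply to \<open>d\<close>, or to \<open>d / 2\<close> when \<open>d\<close> is twice an odd number.\<close>

lemma even_power_of_two_minus_two:
  fixes d :: int
  assumes "d > 0" "d mod 8 = 3 \<or> d mod 8 = 5 \<or> d mod 16 = 6 \<or> d mod 16 = 10" "even x"
  shows "\<not> d dvd 2 ^ x - 2"
proof
  assume dvd: "d dvd 2 ^ x - 2"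
  have "\<exists>m. m > 0 \<and> m mod 8 \<in> {3, 5} \<and> m dvd d"
  proof (cases "d mod 8 = 3 \<or> d mod 8 = 5")
    case False
    with assms(2) have "d mod 16 = 6 \<or> d mod 16 = 10" by blast
    then have "d = 2 * (d div 2)" "d div 2 mod 8 = 3 \<or> d div 2 mod 8 = 5" by presburger+
    moreover from this(1) have "d div 2 dvd d" by (metis dvd_triv_right)
    ultimately show ?thesis using assms(1) by (intro exI[of _ "d div 2"]) auto
  qed (use assms(1) in \<open>auto intro!: exI[of _ d]\<close>)
  then obtain m where m: "m > 0" "m mod 8 \<in> {3, 5}" "m dvd d" by blast
  have eq: "(2::int) ^ x = (2 ^ (x div 2))\<^sup>2" using assms(3) by (simp flip: power_mult)
  have "m dvd (2 ^ (x div 2))\<^sup>2 - 2" using dvd_trans[OF m(3) dvd] by (simp only: eq)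
  with two_not_square_mod m(1,2) show False by blast
qed

lemma even_power_of_two_plus_two:
  fixes d :: int
  assumes "d > 0" "d mod 8 = 5 \<or> d mod 8 = 7 \<or> d mod 16 = 10 \<or> d mod 16 = 14" "even x"
  shows "\<not> d dvd 2 ^ x + 2"
proof
  assume dvd: "d dvd 2 ^ x + 2"
  have "\<exists>m. m > 0 \<and> m mod 8 \<in> {5, 7} \<and> m dvd d"
  proof (cases "d mod 8 = 5 \<or> d mod 8 = 7")
    case False
    with assms(2) have "d mod 16 = 10 \<or> d mod 16 = 14" by blast
    then have "d = 2 * (d div 2)" "d div 2 mod 8 = 5 \<or> d div 2 mod 8 = 7" by presburger+
    moreover from this(1) have "d div 2 dvd d" by (metis dvd_triv_right)
    ultimately show ?thesis using assms(1) by (intro exI[of _ "d div 2"]) auto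
  qed (use assms(1) in \<open>auto intro!: exI[of _ d]\<close>)
  then obtain m where m: "m > 0" "m mod 8 \<in> {5, 7}" "m dvd d" by blast
  have eq: "(2::int) ^ x = (2 ^ (x div 2))\<^sup>2" using assms(3) by (simp flip: power_mult)
  have "m dvd (2 ^ (x div 2))\<^sup>2 + 2" using dvd_trans[OF m(3) dvd] by (simp only: eq)
  with minus_two_not_square_mod m(1,2) show False by blast
qed

text \<open>With \<open>x\<close> odd, \<open>2 ^ x + 2\<close> has the form \<open>2 (u\<^sup>2 + 1)\<close>, so \<open>-1\<close> would be a square.\<close>

lemma odd_power_of_two_plus_two:
  fixes d :: int
  assumes "d > 0" "d mod 4 = 3 \<or> d mod 8 = 6" "odd x"
  shows "\<not> d dvd 2 ^ x + 2"
proof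
  assume dvd: "d dvd 2 ^ x + 2"
  have "\<exists>m. m > 0 \<and> m mod 4 = 3 \<and> m dvd d"
  proof (cases "d mod 4 = 3")
    case False
    with assms(2) have "d mod 8 = 6" by blast
    then have "d = 2 * (d div 2)" "d div 2 mod 4 = 3" by presburger+
    moreover from this(1) have "d div 2 dvd d" by (metis dvd_triv_right)
    ultimately show ?thesis using assms(1) by (intro exI[of _ "d div 2"]) auto
  qed (use assms(1) in \<open>auto intro!: exI[of _ d]\<close>)
  then obtain m where m: "m > 0" "m mod 4 = 3" "m dvd d" by blast
  have "odd m" using m(2) by presburger
  have "x = Suc (x div 2 * 2)" using assms(3) by presburger
  then have "(2::int) ^ x = 2 * (2 ^ (x div 2))\<^sup>2"
    by (metis power_Suc power_mult)
  then have "(2::int) ^ x + 2 = 2 * ((2 ^ (x div 2))\<^sup>2 + 1)" by simp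
  then have "m dvd 2 * ((2 ^ (x div 2))\<^sup>2 + 1)" using dvd_trans[OF m(3) dvd] by (simp only:)
  then have "m dvd (2 ^ (x div 2))\<^sup>2 + 1"
    using \<open>odd m\<close> by (subst (asm) coprime_dvd_mult_right_iff) auto
  with minus_one_not_square_mod m(1,2) show False by blast
qed

lemma mod_shift: "n mod m = r \<Longrightarrow> (n + k) mod m = (r + k) mod m" for n :: int
  by (metis mod_add_left_eq)

lemma four_not_dvd:
  assumes "x \<ge> 2"
  shows "\<not> (4::int) dvd 2 ^ x - 2" "\<not> (4::int) dvd 2 ^ x + 2"
proof -
  have "(2::int) ^ 2 dvd 2 ^ x" using assms by (rule le_imp_power_dvd)
  then show "\<not> (4::int) dvd 2 ^ x - 2" "\<not> (4::int) dvd 2 ^ x + 2" by auto presburger+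
qed

text \<open>Modulo \<open>n + 1\<close> the four bases become \<open>-1, 0, 1, 2\<close>, and modulo \<open>n + 2\<close> they become
\<open>-2, -1, 0, 1\<close>. Each reduction therefore keeps one genuine power, of \<open>2\<close> or \<open>-2\<close>, and
the parity of one other exponent. With signs for \<open>a, b, c, d\<close>, the four equations of the
theorem are instances.\<close>

lemma residues_at_neighbours:
  fixes n a b c d :: int
  assumes "a * n ^ x + b * (n + 1) ^ y + c * (n + 2) ^ z + d * (n + 3) ^ w = 0"
    and "y > 0" "z > 0"
  shows "n + 1 dvd a * (-1) ^ x + c + d * 2 ^ w"
    and "n + 2 dvd a * (-2) ^ x + b * (-1) ^ y + d"
proof -
  have "[n = -1] (mod n + 1)" "[n + 1 = 0] (mod n + 1)" "[n + 2 = 1] (mod n + 1)" "[n + 3 = 2] (mod n + 1)"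
    by (simp_all add: cong_iff_dvd_diff add.commute)
  then have "[a * n ^ x + b * (n + 1) ^ y + c * (n + 2) ^ z + d * (n + 3) ^ w =
      a * (-1) ^ x + b * 0 ^ y + c * 1 ^ z + d * 2 ^ w] (mod n + 1)"
    by (intro cong_add cong_mult cong_pow cong_refl)
  with assms show "n + 1 dvd a * (-1) ^ x + c + d * 2 ^ w"
    by (simp add: cong_sym_eq[of 0] cong_0_iff zero_power)
  have "[n = -2] (mod n + 2)" "[n + 1 = -1] (mod n + 2)" "[n + 2 = 0] (mod n + 2)" "[n + 3 = 1] (mod n + 2)"
    by (simp_all add: cong_iff_dvd_diff add.commute)
  then have "[a * n ^ x + b * (n + 1) ^ y + c * (n + 2) ^ z + d * (n + 3) ^ w =
      a * (-2) ^ x + b * (-1) ^ y + c * 0 ^ z + d * 1 ^ w] (mod n + 2)"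
    by (intro cong_add cong_mult cong_pow cong_refl)
  with assms show "n + 2 dvd a * (-2) ^ x + b * (-1) ^ y + d"
    by (simp add: cong_sym_eq[of 0] cong_0_iff zero_power)
qed

text \<open>All four arguments follow one pattern. The residue modulo \<open>n + 1\<close> fixes the parity of \<open>x\<close>,
because otherwise \<open>n + 1\<close> divides a power of two. Modulo \<open>n + 2\<close>, one parity of \<open>y\<close> makes
\<open>n + 2\<close> divide a power of two, and the other one makes it divide \<open>2 ^ x - 2\<close> or \<open>2 ^ x + 2\<close>,
which the residue class of \<open>n\<close> forbids through a quadratic character or, where \<open>n + 1\<close>
or \<open>n + 2\<close> is a multiple of \<open>4\<close>, through divisibility by \<open>4\<close>.\<close>

lemma equation_i_forces_2:
  fixes n :: int
  assumes "n > 1" "x > 0" "y > 0" "z > 0" "w > 0"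
    and n: "n mod 16 = 4 \<or> n mod 16 = 8 \<or> n mod 8 = 1 \<or> n mod 8 = 2"
    and eq: "n ^ x + (n + 1) ^ y + (n + 2) ^ z = (n + 3) ^ w"
  shows "n = 2"
proof -
  have 1: "n + 1 dvd (-1) ^ x + 1 - 2 ^ w" and 2: "n + 2 dvd (-2) ^ x + (-1) ^ y - 1"
    using residues_at_neighbours[of 1 n x 1 y 1 z "-1" w] eq assms(3,4) by simp_all
  have "even x"
  proof (rule ccontr)
    assume "odd x"
    with 1 have "n + 1 dvd 2 ^ w" by simp
    moreover have "(n + 1) mod 8 \<noteq> 0" using n by (elim disjE) presburger+
    ultimately have "n + 1 \<in> {1, 2, 4}" using \<open>n > 1\<close> by (intro divisor_of_power_of_two) auto
    with n \<open>n > 1\<close> show False by auto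
  qed
  with \<open>x > 0\<close> have "x \<ge> 2" by presburger
  show ?thesis
  proof (cases "even y")
    case True
    with 2 \<open>even x\<close> have "n + 2 dvd 2 ^ x" by simp
    moreover have "(n + 2) mod 8 \<noteq> 0" using n by (elim disjE) presburger+
    ultimately have "n + 2 \<in> {1, 2, 4}" using \<open>n > 1\<close> by (intro divisor_of_power_of_two) auto
    with \<open>n > 1\<close> show ?thesis by auto
  next
    case False
    with 2 \<open>even x\<close> have dvd: "n + 2 dvd 2 ^ x - 2" by simp
    show ?thesis
    proof (cases "n mod 8 = 2")
      case True
      then have "4 dvd n + 2" by presburger
      then have "4 dvd (2::int) ^ x - 2" using dvd by (rule dvd_trans)
      with four_not_dvd(1)[OF \<open>x \<ge> 2\<close>] show ?thesis by blast
    next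
      case False
      with n have "n mod 16 = 4 \<or> n mod 16 = 8 \<or> n mod 8 = 1" by blast
      then have "(n + 2) mod 8 = 3 \<or> (n + 2) mod 8 = 5 \<or> (n + 2) mod 16 = 6 \<or> (n + 2) mod 16 = 10"
        by (elim disjE) (drule mod_shift[where k = 2], simp)+
      then have "\<not> n + 2 dvd 2 ^ x - 2"
        by (rule even_power_of_two_minus_two[OF _ _ \<open>even x\<close>, rotated]) (use \<open>n > 1\<close> in simp)
      with dvd show ?thesis by blast
    qed
  qed
qed

lemma equation_ii_forces_2_or_3:
  fixes n :: int
  assumes "n > 1" "x > 0" "y > 0" "z > 0" "w > 0"
    and n: "n mod 8 = 4 \<or> n mod 4 = 1 \<or> n mod 8 = 2 \<or> n mod 8 = 3"
    and eq: "n ^ x + (n + 1) ^ y = (n + 2) ^ z + (n + 3) ^ w"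
  shows "n = 2 \<or> n = 3"
proof -
  have 1: "n + 1 dvd (-1) ^ x - 1 - 2 ^ w" and 2: "n + 2 dvd (-2) ^ x + (-1) ^ y - 1"
    using residues_at_neighbours[of 1 n x 1 y "-1" z "-1" w] eq assms(3,4) by simp_all
  have small: "n = 2 \<or> n = 3" if "d dvd 2 ^ k" "d = n + 1 \<or> d = n + 2" for d k
  proof -
    have "d mod 8 \<noteq> 0" using n that(2) by (elim disjE) presburger+
    with that \<open>n > 1\<close> have "d \<in> {1, 2, 4}" by (intro divisor_of_power_of_two) auto
    with that(2) \<open>n > 1\<close> show ?thesis by auto
  qed
  show ?thesis
  proof (cases "even x")
    case True
    with 1 show ?thesis by (intro small[of "n + 1" w]) simp_all
  next
    case False
    show ?thesis
    proof (cases "even y")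
      case True
      with 2 False show ?thesis by (intro small[of "n + 2" x]) simp_all
    next
      case odd_y: False
      from 2 False odd_y have "n + 2 dvd - (2 ^ x + 2)" by (simp add: algebra_simps)
      then have 2: "n + 2 dvd 2 ^ x + 2" by (simp only: dvd_minus_iff)
      from 1 False have "n + 1 dvd - (2 ^ w + 2)" by (simp add: algebra_simps)
      then have 1: "n + 1 dvd 2 ^ w + 2" by (simp only: dvd_minus_iff)
      consider (two) "n mod 8 = 2" | (three) "n mod 8 = 3" | (other) "n mod 8 = 4 \<or> n mod 4 = 1"
        using n by blast
      then show ?thesis
      proof cases
        case two
        then have "4 dvd n + 2" by presburger
        then have "4 dvd (2::int) ^ x + 2" using 2 by (rule dvd_trans)
        with four_not_dvd(2)[of x] have "\<not> x \<ge> 2" by blast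
        with \<open>x > 0\<close> have "x = 1" by simp
        with 2 show ?thesis by (intro small[of "n + 2" 2]) simp_all
      next
        case three
        then have "4 dvd n + 1" by presburger
        then have "4 dvd (2::int) ^ w + 2" using 1 by (rule dvd_trans)
        with four_not_dvd(2)[of w] have "\<not> w \<ge> 2" by blast
        with \<open>w > 0\<close> have "w = 1" by simp
        with 1 show ?thesis by (intro small[of "n + 1" 2]) simp_all
      next
        case other
        then have "(n + 2) mod 4 = 3 \<or> (n + 2) mod 8 = 6" by (elim disjE) (drule mod_shift[where k = 2], simp)+
        then have "\<not> n + 2 dvd 2 ^ x + 2"
          by (rule odd_power_of_two_plus_two[OF _ _ \<open>odd x\<close>, rotated]) (use \<open>n > 1\<close> in simp)
        with 2 show ?thesis by blast
      qed
    qed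
  qed
qed

text \<open>The class \<open>n \<equiv> 6 (mod 8)\<close> is settled at \<open>n + 1 \<equiv> 7 (mod 8)\<close> already: neither \<open>-1\<close> nor
\<open>-2\<close> is a square there, whatever the parity of \<open>w\<close>.\<close>

lemma equation_iii_forces_2_or_3:
  fixes n :: int
  assumes "n > 1" "x > 0" "y > 0" "z > 0" "w > 0"
    and n: "n mod 16 = 8 \<or> n mod 16 = 12 \<or> n mod 8 = 5 \<or> n mod 4 = 2 \<or> n mod 8 = 3"
    and eq: "n ^ x + (n + 2) ^ z + (n + 3) ^ w = (n + 1) ^ y"
  shows "n = 2 \<or> n = 3"
proof -
  have 1: "n + 1 dvd (-1) ^ x + 1 + 2 ^ w" and 2: "n + 2 dvd (-2) ^ x - (-1) ^ y + 1"
    using residues_at_neighbours[of 1 n x "-1" y 1 z 1 w] eq assms(3,4) by simp_all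
  have small: "n = 2 \<or> n = 3" if "d dvd 2 ^ k" "d = n + 1 \<or> d = n + 2" "d mod 8 \<noteq> 0" for d k
  proof -
    from that \<open>n > 1\<close> have "d \<in> {1, 2, 4}" by (intro divisor_of_power_of_two) auto
    with that(2) \<open>n > 1\<close> show ?thesis by auto
  qed
  have 3: "(n + 1) mod 8 \<noteq> 0" using n by (elim disjE) presburger+
  show ?thesis
  proof (cases "even x")
    case False
    with 1 3 show ?thesis by (intro small[of "n + 1" w]) simp_all
  next
    case True
    with \<open>x > 0\<close> have "x \<ge> 2" by presburger
    show ?thesis
    proof (cases "n mod 8 = 6")
      case True
      from 1 \<open>even x\<close> have dvd: "n + 1 dvd 2 ^ w + 2" by (simp add: add.commute)
      have "(n + 1) mod 8 = 7" "(n + 1) mod 4 = 3" "n + 1 > 0"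
        using True \<open>n > 1\<close> by presburger+
      then have "\<not> n + 1 dvd 2 ^ w + 2"
        using even_power_of_two_plus_two[of "n + 1" w] odd_power_of_two_plus_two[of "n + 1" w]
        by blast
      with dvd show ?thesis by blast
    next
      case not_6: False
      from not_6 have 4: "(n + 2) mod 8 \<noteq> 0" by presburger
      show ?thesis
      proof (cases "even y")
        case True
        with 2 4 \<open>even x\<close> show ?thesis by (intro small[of "n + 2" x]) simp_all
      next
        case False
        with 2 \<open>even x\<close> have dvd: "n + 2 dvd 2 ^ x + 2" by (simp add: add.commute)
        show ?thesis
        proof (cases "n mod 8 = 2")
          case True
          then have "4 dvd n + 2" by presburger
          then have "4 dvd (2::int) ^ x + 2" using dvd by (rule dvd_trans)
          with four_not_dvd(2)[OF \<open>x \<ge> 2\<close>] show ?thesis by blast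
        next
          case False
          with not_6 have "n mod 4 \<noteq> 2" by presburger
          with n have "n mod 16 = 8 \<or> n mod 16 = 12 \<or> n mod 8 = 5 \<or> n mod 8 = 3" by blast
          then have "(n + 2) mod 8 = 5 \<or> (n + 2) mod 8 = 7 \<or> (n + 2) mod 16 = 10 \<or> (n + 2) mod 16 = 14"
            by (elim disjE) (drule mod_shift[where k = 2], simp)+
          then have "\<not> n + 2 dvd 2 ^ x + 2"
            by (rule even_power_of_two_plus_two[OF _ _ \<open>even x\<close>, rotated]) (use \<open>n > 1\<close> in simp)
          with dvd show ?thesis by blast
        qed
      qed
    qed
  qed
qed

lemma equation_iv_forces_2_or_3:
  fixes n :: int
  assumes "n > 1" "x > 0" "y > 0" "z > 0" "w > 0"
    and n: "n mod 16 = 4 \<or> n mod 16 = 8 \<or> n mod 8 = 1 \<or> n mod 8 = 2 \<or> n mod 8 = 3"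
    and eq: "n ^ x + (n + 2) ^ z = (n + 1) ^ y + (n + 3) ^ w"
  shows "n = 2 \<or> n = 3"
proof -
  have 1: "n + 1 dvd (-1) ^ x + 1 - 2 ^ w" and 2: "n + 2 dvd (-2) ^ x - (-1) ^ y - 1"
    using residues_at_neighbours[of 1 n x "-1" y 1 z "-1" w] eq assms(3,4) by simp_all
  have small: "n = 2 \<or> n = 3" if "d dvd 2 ^ k" "d = n + 1 \<or> d = n + 2" for d k
  proof -
    have "d mod 8 \<noteq> 0" using n that(2) by (elim disjE) presburger+
    with that \<open>n > 1\<close> have "d \<in> {1, 2, 4}" by (intro divisor_of_power_of_two) auto
    with that(2) \<open>n > 1\<close> show ?thesis by auto
  qed
  show ?thesis
  proof (cases "even x")
    case False
    with 1 show ?thesis by (intro small[of "n + 1" w]) simp_all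
  next
    case True
    with \<open>x > 0\<close> have "x \<ge> 2" by presburger
    show ?thesis
    proof (cases "even y")
      case False
      with 2 True show ?thesis by (intro small[of "n + 2" x]) simp_all
    next
      case even_y: True
      with 2 \<open>even x\<close> have dvd: "n + 2 dvd 2 ^ x - 2" by simp
      show ?thesis
      proof (cases "n mod 8 = 2")
        case True
        then have "4 dvd n + 2" by presburger
        then have "4 dvd (2::int) ^ x - 2" using dvd by (rule dvd_trans)
        with four_not_dvd(1)[OF \<open>x \<ge> 2\<close>] show ?thesis by blast
      next
        case False
        with n have "n mod 16 = 4 \<or> n mod 16 = 8 \<or> n mod 8 = 1 \<or> n mod 8 = 3" by blast
        then have "(n + 2) mod 8 = 3 \<or> (n + 2) mod 8 = 5 \<or> (n + 2) mod 16 = 6 \<or> (n + 2) mod 16 = 10"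
          by (elim disjE) (drule mod_shift[where k = 2], simp)+
        then have "\<not> n + 2 dvd 2 ^ x - 2"
          by (rule even_power_of_two_minus_two[OF _ _ \<open>even x\<close>, rotated]) (use \<open>n > 1\<close> in simp)
        with dvd show ?thesis by blast
      qed
    qed
  qed
qed

section \<open>A sieve for exponents\<close>

text \<open>The equations that remain have the form \<open>\<Sum> c\<^sub>i b\<^sub>i ^ e\<^sub>i = 0\<close> with constants \<open>c\<^sub>i, b\<^sub>i\<close> and
unknown exponents \<open>e\<^sub>i\<close>. The search keeps a list of boxes, that is, of tuples of arithmetic
progressions of exponents, which together contain every solution. A pair \<open>(r, p)\<close> stands for
the progression \<open>r, r + p, r + 2 p, \<dots>\<close>; the period \<open>p = 0\<close> gives the single exponent \<open>r\<close>.

Moduli prime to the bases can never exclude the residue classes of a true solution. What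
separates the larger exponents from it is a modulus sharing a factor with the base: once
\<open>e > e\<^sub>0\<close>, the power \<open>b ^ e\<close> vanishes modulo \<open>b ^ (e\<^sub>0 + 1)\<close>. Hence small exponents are first
split off as single values, and each tail beyond them is refined into residue classes.\<close>

type_synonym progression = "nat \<times> nat"

definition members :: "progression \<Rightarrow> nat set" where
  "members = (\<lambda>(r, p). {r + p * i | i. True})"

text \<open>The common value \<open>v\<close> of a term on a progression, if it is visibly constant there; \<open>g\<close> is the
factor that one period contributes. Testing \<open>v * (g - 1)\<close> instead of \<open>g - 1\<close> covers units and
nilpotent bases modulo \<open>M\<close> alike.\<close>

definition constant_residue :: "int \<Rightarrow> nat \<Rightarrow> int \<Rightarrow> int \<Rightarrow> int option" where
  "constant_residue M p v g = (if p = 0 \<or> v * (g - 1) mod M = 0 then Some v else None)"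

definition residue :: "int \<Rightarrow> int \<Rightarrow> int \<Rightarrow> progression \<Rightarrow> int option" where
  "residue M c b = (\<lambda>(r, p). constant_residue M p (c * mod_exp b r M mod M) (mod_exp b p M))"

definition split_off :: "nat \<Rightarrow> progression list" where
  "split_off T = map (\<lambda>e. (e, 0)) [1..<T] @ [(T, 1)]"

definition refine :: "nat \<Rightarrow> progression \<Rightarrow> progression list" where
  "refine f = (\<lambda>(r, p). if p = 0 then [(r, 0)] else map (\<lambda>j. (r + p * j, f * p)) [0..<f])"

fun add_known :: "int option \<Rightarrow> int option \<Rightarrow> int option" where
  "add_known (Some u) (Some v) = Some (u + v)"
| "add_known _ _ = None"

text \<open>The residues of the single terms are computed once per progression rather than once per box,
and the boxes are then enumerated with the partial sum as an accumulator, so that only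
survivors are ever stored. Separate recursions without local abbreviations keep the evaluation
inside the logic affordable: rewriting does not share the value of a \<open>let\<close>.\<close>

fun column :: "int \<Rightarrow> int \<times> int \<Rightarrow> progression list \<Rightarrow> (int option \<times> progression) list" where
  "column M (c, b) [] = []"
| "column M (c, b) (q # P) = (residue M c b q, q) # column M (c, b) P"

fun columns ::
  "int \<Rightarrow> (int \<times> int) list \<Rightarrow> progression list list \<Rightarrow> (int option \<times> progression) list list" where
  "columns M (t # ts) (P # Ps) = column M t P # columns M ts Ps"
| "columns M _ _ = []"

fun surviving_boxes ::
  "int \<Rightarrow> (int option \<times> progression) list list \<Rightarrow> int option \<Rightarrow> progression list list" where
  "surviving_boxes M [] None = [[]]"
| "surviving_boxes M [] (Some s) = (if s mod M = 0 then [[]] else [])"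
| "surviving_boxes M ([] # cols) acc = []"
| "surviving_boxes M (((v, q) # col) # cols) acc =
     map ((#) q) (surviving_boxes M cols (add_known acc v)) @ surviving_boxes M (col # cols) acc"

definition sift :: "int \<Rightarrow> (int \<times> int) list \<Rightarrow> progression list list \<Rightarrow> progression list list" where
  "sift M ts Ps = surviving_boxes M (columns M ts Ps) (Some 0)"

text \<open>A step \<open>(f, M)\<close> splits each infinite progression into \<open>f\<close> classes and then discards the boxes
on which the sum is a nonzero constant modulo \<open>M\<close>; a step with \<open>f = 1\<close> merely tests another
modulus. Steps are ordered so that few boxes are alive whenever \<open>f > 1\<close>.\<close>

fun refine_and_sift ::
  "(int \<times> int) list \<Rightarrow> (nat \<times> int) list \<Rightarrow> progression list list \<Rightarrow> progression list list" where
  "refine_and_sift ts [] qss = qss"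
| "refine_and_sift ts ((f, M) # steps) qss =
     refine_and_sift ts steps (concat (map (\<lambda>qs. sift M ts (map (refine f) qs)) qss))"

definition exponent_sieve ::
  "(int \<times> int) list \<Rightarrow> nat list \<Rightarrow> int \<Rightarrow> (nat \<times> int) list \<Rightarrow> progression list list" where
  "exponent_sieve ts Ts M steps = refine_and_sift ts steps (sift M ts (map split_off Ts))"

fun exp_sum :: "(int \<times> int) list \<Rightarrow> nat list \<Rightarrow> int" where
  "exp_sum ((c, b) # ts) (e # es) = c * b ^ e + exp_sum ts es"
| "exp_sum _ _ = 0"

lemma residue_correct:
  assumes "residue M c b q = Some v" and "e \<in> members q"
  shows "[c * b ^ e = v] (mod M)"
proof -
  obtain r p where q: "q = (r, p)" by (cases q)
  then obtain i where e: "e = r + p * i" using assms(2) by (auto simp: members_def)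
  have v: "v = c * (b ^ r mod M) mod M"
    and const: "p = 0 \<or> v * (b ^ p mod M - 1) mod M = 0"
    using assms(1) by (auto simp: residue_def constant_residue_def q mod_exp_def split: if_splits)
  have v': "[c * b ^ r = v] (mod M)"
    by (simp add: v cong_def mod_mult_right_eq)
  have "[c * b ^ r * b ^ (p * i) = c * b ^ r] (mod M)"
  proof (cases "p = 0")
    case False
    have "[c * b ^ r * (b ^ p - 1) = v * (b ^ p mod M - 1)] (mod M)"
      by (intro cong_mult cong_diff v' cong_refl) (simp add: cong_def)
    also have "[v * (b ^ p mod M - 1) = 0] (mod M)"
      using const False by (simp add: cong_def)
    finally have "M dvd c * b ^ r * (b ^ p - 1)"
      by (simp add: cong_0_iff)
    moreover have "b ^ p - 1 dvd b ^ (p * i) - 1"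
      using power_diff_1_eq[of "b ^ p" i] by (simp add: power_mult)
    ultimately have "M dvd c * b ^ r * (b ^ (p * i) - 1)"
      by (meson dvd_refl dvd_trans mult_dvd_mono)
    then show ?thesis
      by (simp add: cong_iff_dvd_diff algebra_simps)
  qed simp
  with v' show ?thesis
    by (simp add: e power_add mult.assoc) (metis cong_trans)
qed

lemma set_column: "set (column M (c, b) P) = (\<lambda>q. (residue M c b q, q)) ` set P"
  by (induction P) auto

lemma surviving_boxes_Cons:
  assumes "(v, q) \<in> set col" "qs \<in> set (surviving_boxes M cols (add_known acc v))"
  shows "q # qs \<in> set (surviving_boxes M (col # cols) acc)"
  using assms by (induction col) auto

lemma surviving_boxes_complete:
  assumes "list_all2 (\<lambda>e P. \<exists>q \<in> set P. e \<in> members q) es Ps" and "length ts = length es"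
    and "\<forall>a. acc = Some a \<longrightarrow> [A = a] (mod M)" and "A + exp_sum ts es = 0"
  shows "\<exists>qs \<in> set (surviving_boxes M (columns M ts Ps) acc). list_all2 (\<lambda>e q. e \<in> members q) es qs"
  using assms
proof (induction es Ps arbitrary: ts acc A rule: list_all2_induct)
  case Nil
  then show ?case by (cases acc) (auto simp: cong_def)
next
  case (Cons e es P Ps)
  then obtain c b ts' where ts: "ts = (c, b) # ts'" by (cases ts) auto
  obtain q where q: "q \<in> set P" "e \<in> members q" using Cons.hyps by blast
  have "[A + c * b ^ e = a] (mod M)" if s: "add_known acc (residue M c b q) = Some a" for a
  proof -
    obtain u v where "acc = Some u" "residue M c b q = Some v" "a = u + v"
      using s by (cases acc; cases "residue M c b q") auto
    then show ?thesis
      using residue_correct[OF _ q(2)] Cons.prems(2) by (auto intro: cong_add)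
  qed
  moreover have "length ts' = length es" "A + c * b ^ e + exp_sum ts' es = 0"
    using Cons.prems by (simp_all add: ts)
  ultimately obtain qs where
    "qs \<in> set (surviving_boxes M (columns M ts' Ps) (add_known acc (residue M c b q)))"
    "list_all2 (\<lambda>e q. e \<in> members q) es qs"
    using Cons.IH by blast
  then show ?case
    using q surviving_boxes_Cons[of "residue M c b q" q "column M (c, b) P"]
    by (auto simp: ts set_column intro!: bexI[of _ "q # qs"])
qed

lemma sift_complete:
  assumes "list_all2 (\<lambda>e P. \<exists>q \<in> set P. e \<in> members q) es Ps" "length ts = length es"
    and "exp_sum ts es = 0"
  shows "\<exists>qs \<in> set (sift M ts Ps). list_all2 (\<lambda>e q. e \<in> members q) es qs"
  using surviving_boxes_complete[OF assms(1,2), of "Some 0" 0 M] assms(3) by (simp add: sift_def)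

lemma refine_covers:
  assumes "e \<in> members q" "f > 0"
  shows "\<exists>q' \<in> set (refine f q). e \<in> members q'"
proof -
  obtain r p where q: "q = (r, p)" by (cases q)
  then obtain i where e: "e = r + p * i" using assms(1) by (auto simp: members_def)
  have "e = (r + p * (i mod f)) + (f * p) * (i div f)"
    using e by (metis add.assoc mult.commute mult.left_commute distrib_left mod_mult_div_eq)
  then show ?thesis
    using assms(2) by (auto simp: q members_def refine_def e intro!: bexI[of _ "i mod f"])
qed

lemma split_off_covers:
  assumes "e > 0" "T > 0"
  shows "\<exists>q \<in> set (split_off T). e \<in> members q"
proof (cases "e < T")
  case True
  with assms show ?thesis by (auto simp: split_off_def members_def)
next
  case False
  then have "e = T + 1 * (e - T)" by simp
  then have "e \<in> members (T, 1)" unfolding members_def by blast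
  then show ?thesis by (auto simp: split_off_def)
qed

lemma refine_and_sift_complete:
  assumes "\<exists>qs \<in> set qss. list_all2 (\<lambda>e q. e \<in> members q) es qs"
    and "length ts = length es" "exp_sum ts es = 0" "\<forall>(f, M) \<in> set steps. f > 0"
  shows "\<exists>qs \<in> set (refine_and_sift ts steps qss). list_all2 (\<lambda>e q. e \<in> members q) es qs"
  using assms(1,4)
proof (induction steps arbitrary: qss)
  case (Cons step steps)
  obtain f M where step: "step = (f, M)" by (cases step)
  with Cons.prems(2) have "f > 0" by auto
  obtain qs where qs: "qs \<in> set qss" "list_all2 (\<lambda>e q. e \<in> members q) es qs"
    using Cons.prems(1) by blast
  have "list_all2 (\<lambda>e P. \<exists>q \<in> set P. e \<in> members q) es (map (refine f) qs)"
    using qs(2) refine_covers[OF _ \<open>f > 0\<close>]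
    by (simp add: list_all2_conv_all_nth)
  from sift_complete[OF this assms(2,3), of M] obtain qs' where
    "qs' \<in> set (sift M ts (map (refine f) qs))" "list_all2 (\<lambda>e q. e \<in> members q) es qs'"
    by blast
  with qs(1) have "\<exists>qs \<in> set (concat (map (\<lambda>qs. sift M ts (map (refine f) qs)) qss)).
    list_all2 (\<lambda>e q. e \<in> members q) es qs"
    by auto
  from Cons.IH[OF this] Cons.prems(2) show ?case
    by (simp add: step)
qed simp

text \<open>Splitting and refining lose no exponents, and a box containing a solution survives every test
because its residue, if known, is \<open>0\<close>. A bad choice of moduli can only leave more boxes; it
never loses a solution.\<close>

theorem exponent_sieve_complete:
  assumes "exp_sum ts es = 0" "length ts = length es" "length Ts = length es"
    and "\<forall>e \<in> set es. e > 0" "\<forall>T \<in> set Ts. T > 0" "\<forall>(f, M) \<in> set steps. f > 0"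
  shows "\<exists>qs \<in> set (exponent_sieve ts Ts M steps). list_all2 (\<lambda>e q. e \<in> members q) es qs"
proof -
  have "list_all2 (\<lambda>e P. \<exists>q \<in> set P. e \<in> members q) es (map split_off Ts)"
    using assms(3-5) split_off_covers by (simp add: list_all2_conv_all_nth)
  from refine_and_sift_complete[OF sift_complete[OF this assms(2,1)] assms(2,1,6)]
  show ?thesis
    by (simp add: exponent_sieve_def)
qed

lemma members_iff [simp]: "e \<in> members (r, p) \<longleftrightarrow> (\<exists>i. e = r + p * i)"
  by (auto simp: members_def)

section \<open>The equations for the bases 2 and 3\<close>

text \<open>The thresholds lie one above the largest exponent that occurs in a solution. A modulus prime to
the bases is a prime power modulo which the orders of all bases divide the period reached so
far; the periods grow through small factors up to \<open>4\<close>, \<open>100\<close>, \<open>300\<close>, \<open>96\<close>, \<open>192\<close> and \<open>1800\<close>.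
The decisive step combines a high power of a base, modulo which large powers of that base
vanish, with a prime for the same period: modulo \<open>125\<close> the other bases have orders dividing
\<open>100\<close>, and the prime \<open>101\<close>, or \<open>1201\<close> for the period \<open>1800\<close>, carries the resulting condition
over to the power of \<open>5\<close>. The pairs \<open>64, 17\<close> and \<open>128, 97\<close> and \<open>256, 193\<close> do the same for
the even bases.\<close>

lemma sieve_2_3_4_to_5: "exponent_sieve [(1, 2), (1, 3), (1, 4), (-1, 5)] [1, 1, 1, 1] 2 [(2, 3), (1, 4), (2, 5)] = []"
  by code_simp

lemma sieve_2_4_5_to_3: "exponent_sieve [(1, 2), (1, 4), (1, 5), (-1, 3)] [1, 1, 1, 1] 2 [(2, 3), (1, 4), (2, 5)] = []"
  by code_simp

lemma sieve_3_4_to_5_6: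
  "exponent_sieve [(1, 3), (1, 4), (-1, 5), (-1, 6)] [4, 2, 3, 2]
     16 [(1, 125), (1, 81), (2, 4), (1, 3), (1, 8), (2, 5), (1, 16), (5, 11), (1, 25), (5, 101), (1, 125)] =
   [[(3, 0), (1, 0), (2, 0), (1, 0)]]"
  by code_simp

lemma sieve_3_5_6_to_4:
  "exponent_sieve [(1, 3), (1, 5), (1, 6), (-1, 4)] [2, 3, 3, 4]
     27 [(1, 125), (1, 128), (2, 8), (1, 3), (1, 27), (2, 5), (1, 16), (3, 13), (1, 7), (1, 9), (5, 61),
         (5, 101), (1, 125)] =
   [[(1, 0), (2, 0), (2, 0), (3, 0)]]"
  by code_simp

lemma sieve_3_5_to_4_6:
  "exponent_sieve [(1, 3), (1, 5), (-1, 4), (-1, 6)] [4, 3, 3, 3]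
     27 [(1, 32), (1, 125), (2, 8), (1, 3), (1, 81), (2, 5), (1, 16), (3, 7), (1, 13), (2, 32), (2, 17),
         (1, 64), (2, 128), (1, 97)] =
   [[(3, 0), (2, 0), (2, 0), (2, 0)], [(99, 96), (98, 96), (2, 0), (2, 0)]]"
  by code_simp

lemma sieve_2_4_to_3_5:
  "exponent_sieve [(1, 2), (1, 4), (-1, 3), (-1, 5)] [7, 4, 4, 4]
     128 [(1, 81), (1, 625), (2, 3), (1, 8), (1, 256), (2, 5), (1, 16), (3, 13), (1, 7), (1, 9), (2, 32),
          (2, 17), (1, 64), (2, 97), (1, 128), (2, 193), (1, 256)] =
   [[(2, 0), (1, 0), (1, 0), (1, 0)], [(4, 0), (2, 0), (3, 0), (1, 0)],
    [(4, 0), (2, 0), (195, 192), (193, 192)], [(6, 0), (3, 0), (1, 0), (3, 0)]]"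
  by code_simp

lemma sieve_2_3_to_4_5:
  "exponent_sieve [(1, 2), (1, 3), (-1, 4), (-1, 5)] [6, 5, 4, 3]
     64 [(1, 125), (1, 243), (2, 8), (1, 3), (1, 128), (2, 5), (1, 16), (3, 13), (1, 7), (1, 9), (3, 19),
         (1, 27), (1, 37), (2, 32), (1, 73), (5, 181), (1, 241), (5, 1201), (1, 125)] =
   [[(1, 0), (3, 0), (1, 0), (2, 0)], [(3, 0), (4, 0), (3, 0), (2, 0)],
    [(3, 0), (1804, 1800), (903, 1800), (2, 0)], [(3, 0), (1804, 1800), (1803, 1800), (2, 0)],
    [(5, 0), (2, 0), (2, 0), (2, 0)]]"
  by code_simp

lemma no_solution_2_3_4_to_5:
  assumes "x > 0" "y > 0" "z > 0" "w > 0"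
  shows "(2::int) ^ x + 3 ^ y + 4 ^ z \<noteq> 5 ^ w"
proof
  assume "(2::int) ^ x + 3 ^ y + 4 ^ z = 5 ^ w"
  then have "exp_sum [(1, 2), (1, 3), (1, 4), (-1, 5)] [x, y, z, w] = 0" by simp
  then have "\<exists>qs \<in> set []. list_all2 (\<lambda>e q. e \<in> members q) [x, y, z, w] qs"
    unfolding sieve_2_3_4_to_5[symmetric]
    by (rule exponent_sieve_complete) (use assms in auto)
  then show False by simp
qed

lemma no_solution_2_4_5_to_3:
  assumes "x > 0" "y > 0" "z > 0" "w > 0"
  shows "(2::int) ^ x + 4 ^ z + 5 ^ w \<noteq> 3 ^ y"
proof
  assume "(2::int) ^ x + 4 ^ z + 5 ^ w = 3 ^ y"
  then have "exp_sum [(1, 2), (1, 4), (1, 5), (-1, 3)] [x, z, w, y] = 0" by simp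
  then have "\<exists>qs \<in> set []. list_all2 (\<lambda>e q. e \<in> members q) [x, z, w, y] qs"
    unfolding sieve_2_4_5_to_3[symmetric]
    by (rule exponent_sieve_complete) (use assms in auto)
  then show False by simp
qed

lemma solutions_3_4_to_5_6:
  assumes "x > 0" "y > 0" "z > 0" "w > 0" "(3::int) ^ x + 4 ^ y = 5 ^ z + 6 ^ w"
  shows "(x, y, z, w) = (3, 1, 2, 1)"
proof -
  from assms(5) have "exp_sum [(1, 3), (1, 4), (-1, 5), (-1, 6)] [x, y, z, w] = 0" by simp
  then have "\<exists>qs \<in> set [[(3, 0), (1, 0), (2, 0), (1, 0)]]. list_all2 (\<lambda>e q. e \<in> members q) [x, y, z, w] qs"
    unfolding sieve_3_4_to_5_6[symmetric]
    by (rule exponent_sieve_complete) (use assms in auto)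
  then show ?thesis by simp
qed

lemma solutions_3_5_6_to_4:
  assumes "x > 0" "y > 0" "z > 0" "w > 0" "(3::int) ^ x + 5 ^ z + 6 ^ w = 4 ^ y"
  shows "(x, y, z, w) = (1, 3, 2, 2)"
proof -
  from assms(5) have "exp_sum [(1, 3), (1, 5), (1, 6), (-1, 4)] [x, z, w, y] = 0" by simp
  then have "\<exists>qs \<in> set [[(1, 0), (2, 0), (2, 0), (3, 0)]]. list_all2 (\<lambda>e q. e \<in> members q) [x, z, w, y] qs"
    unfolding sieve_3_5_6_to_4[symmetric]
    by (rule exponent_sieve_complete) (use assms in auto)
  then show ?thesis by simp
qed

text \<open>Modulo anything prime to the bases, the second box cannot be told apart from the solution, but
its fixed exponents give \<open>3 ^ x + 5 ^ z = 52\<close> with a huge \<open>x\<close>.\<close>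

lemma solutions_3_5_to_4_6:
  assumes "x > 0" "y > 0" "z > 0" "w > 0" "(3::int) ^ x + 5 ^ z = 4 ^ y + 6 ^ w"
  shows "(x, y, z, w) = (3, 2, 2, 2)"
proof -
  from assms(5) have "exp_sum [(1, 3), (1, 5), (-1, 4), (-1, 6)] [x, z, y, w] = 0" by simp
  then have "\<exists>qs \<in> set [[(3, 0), (2, 0), (2, 0), (2, 0)], [(99, 96), (98, 96), (2, 0), (2, 0)]].
      list_all2 (\<lambda>e q. e \<in> members q) [x, z, y, w] qs"
    unfolding sieve_3_5_to_4_6[symmetric]
    by (rule exponent_sieve_complete) (use assms in auto)
  then consider "(x, y, z, w) = (3, 2, 2, 2)" | "x \<ge> 99" "y = 2" "w = 2" by auto
  then show ?thesis
  proof cases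
    case 2
    then have "(3::int) ^ 4 \<le> 3 ^ x" by (intro power_increasing) auto
    moreover have "(5::int) ^ z > 0" by simp
    moreover have "(3::int) ^ x + 5 ^ z = 52" using assms(5) 2 by simp
    ultimately show ?thesis by simp
  qed
qed

lemma solutions_2_4_to_3_5:
  assumes "x > 0" "y > 0" "z > 0" "w > 0" "(2::int) ^ x + 4 ^ z = 3 ^ y + 5 ^ w"
  shows "(x, y, z, w) \<in> {(2, 1, 1, 1), (4, 3, 2, 1), (6, 1, 3, 3)}"
proof -
  from assms(5) have "exp_sum [(1, 2), (1, 4), (-1, 3), (-1, 5)] [x, z, y, w] = 0" by simp
  then have "\<exists>qs \<in> set [[(2, 0), (1, 0), (1, 0), (1, 0)], [(4, 0), (2, 0), (3, 0), (1, 0)],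
      [(4, 0), (2, 0), (195, 192), (193, 192)], [(6, 0), (3, 0), (1, 0), (3, 0)]].
      list_all2 (\<lambda>e q. e \<in> members q) [x, z, y, w] qs"
    unfolding sieve_2_4_to_3_5[symmetric]
    by (rule exponent_sieve_complete) (use assms in auto)
  then consider "(x, y, z, w) \<in> {(2, 1, 1, 1), (4, 3, 2, 1), (6, 1, 3, 3)}" | "x = 4" "z = 2" "y \<ge> 195"
    by auto
  then show ?thesis
  proof cases
    case 2
    then have "(3::int) ^ 4 \<le> 3 ^ y" by (intro power_increasing) auto
    moreover have "(5::int) ^ w > 0" by simp
    moreover have "(3::int) ^ y + 5 ^ w = 32" using assms(5) 2 by simp
    ultimately show ?thesis by simp
  qed
qed

text \<open>The boxes with two open exponents amount to \<open>3 ^ y = 4 ^ z + 17\<close>. The sieve has shown that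
\<open>y\<close> is even there, so that \<open>17\<close> is a difference of two squares, whose sum of roots is far
too large.\<close>

lemma solutions_2_3_to_4_5:
  assumes "x > 0" "y > 0" "z > 0" "w > 0" "(2::int) ^ x + 3 ^ y = 4 ^ z + 5 ^ w"
  shows "(x, y, z, w) \<in> {(1, 3, 1, 2), (3, 4, 3, 2), (5, 2, 2, 2)}"
proof -
  from assms(5) have "exp_sum [(1, 2), (1, 3), (-1, 4), (-1, 5)] [x, y, z, w] = 0" by simp
  then have "\<exists>qs \<in> set [[(1, 0), (3, 0), (1, 0), (2, 0)], [(3, 0), (4, 0), (3, 0), (2, 0)],
      [(3, 0), (1804, 1800), (903, 1800), (2, 0)], [(3, 0), (1804, 1800), (1803, 1800), (2, 0)],
      [(5, 0), (2, 0), (2, 0), (2, 0)]]. list_all2 (\<lambda>e q. e \<in> members q) [x, y, z, w] qs"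
    unfolding sieve_2_3_to_4_5[symmetric]
    by (rule exponent_sieve_complete) (use assms in auto)
  then consider "(x, y, z, w) \<in> {(1, 3, 1, 2), (3, 4, 3, 2), (5, 2, 2, 2)}"
    | "x = 3" "w = 2" "z \<ge> 903" "even y"
    by auto
  then show ?thesis
  proof cases
    case 2
    define b where "b = (3::int) ^ (y div 2)"
    define c where "c = (2::int) ^ z"
    have "(3::int) ^ y = b * b" using \<open>even y\<close> by (simp add: b_def flip: power_add mult_2)
    moreover have "(4::int) ^ z = c * c" by (simp add: c_def flip: power_mult_distrib)
    ultimately have *: "(b - c) * (b + c) = 17" using assms(5) 2 by (simp add: algebra_simps)
    have "b > 0" by (simp add: b_def)
    have "(2::int) ^ 5 \<le> c" unfolding c_def using 2 by (intro power_increasing) auto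
    then have "b + c > 17" using \<open>b > 0\<close> by simp
    with * have "b - c > 0" using zero_less_mult_pos2[of "b - c" "b + c"] by simp
    then have "1 * (b + c) \<le> (b - c) * (b + c)" using \<open>b + c > 17\<close> by (intro mult_right_mono) auto
    with * \<open>b + c > 17\<close> show ?thesis by simp
  qed
qed

lemma solution_set_eqI:
  assumes "\<And>x y z w. x > 0 \<Longrightarrow> y > 0 \<Longrightarrow> z > 0 \<Longrightarrow> w > 0 \<Longrightarrow> P x y z w \<Longrightarrow> (x, y, z, w) \<in> S"
    and "\<And>x y z w. (x, y, z, w) \<in> S \<Longrightarrow> x > 0 \<and> y > 0 \<and> z > 0 \<and> w > 0 \<and> P x y z w"
  shows "{(x :: nat, y :: nat, z :: nat, w :: nat). x > 0 \<and> y > 0 \<and> z > 0 \<and> w > 0 \<and> P x y z w} = S"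
proof (rule Set.set_eqI)
  fix t :: "nat \<times> nat \<times> nat \<times> nat"
  obtain x y z w where t: "t = (x, y, z, w)" by (cases t)
  show "t \<in> {(x, y, z, w). x > 0 \<and> y > 0 \<and> z > 0 \<and> w > 0 \<and> P x y z w} \<longleftrightarrow> t \<in> S"
    using assms[of x y z w] by (auto simp: t)
qed

section \<open>The four equations\<close>

theorem theorem2:
  fixes n :: int
  assumes "n > 1"
  shows
    "([n = 4] (mod 16) \<or> [n = 8] (mod 16) \<or> [n = 1] (mod 8) \<or> [n = 2] (mod 8) \<longrightarrow>
      \<not> (\<exists>(x::nat) (y::nat) (z::nat) (w::nat). x > 0 \<and> y > 0 \<and> z > 0 \<and> w > 0 \<and>
          n ^ x + (n + 1) ^ y + (n + 2) ^ z = (n + 3) ^ w)) \<and>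
     ([n = 4] (mod 8) \<or> [n = 1] (mod 4) \<or> [n = 2] (mod 8) \<or> [n = 3] (mod 8) \<longrightarrow>
      {(x::nat, y::nat, z::nat, w::nat). x > 0 \<and> y > 0 \<and> z > 0 \<and> w > 0 \<and>
          n ^ x + (n + 1) ^ y = (n + 2) ^ z + (n + 3) ^ w} =
      (if n = 2 then {(1, 3, 1, 2), (3, 4, 3, 2), (5, 2, 2, 2)}
       else if n = 3 then {(3, 1, 2, 1)}
       else {})) \<and>
     ([n = 8] (mod 16) \<or> [n = 12] (mod 16) \<or> [n = 5] (mod 8) \<or> [n = 2] (mod 4) \<or> [n = 3] (mod 8) \<longrightarrow>
      {(x::nat, y::nat, z::nat, w::nat). x > 0 \<and> y > 0 \<and> z > 0 \<and> w > 0 \<and>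
          n ^ x + (n + 2) ^ z + (n + 3) ^ w = (n + 1) ^ y} =
      (if n = 3 then {(1, 3, 2, 2)} else {})) \<and>
     ([n = 4] (mod 16) \<or> [n = 8] (mod 16) \<or> [n = 1] (mod 8) \<or> [n = 2] (mod 8) \<or> [n = 3] (mod 8) \<longrightarrow>
      {(x::nat, y::nat, z::nat, w::nat). x > 0 \<and> y > 0 \<and> z > 0 \<and> w > 0 \<and>
          n ^ x + (n + 2) ^ z = (n + 1) ^ y + (n + 3) ^ w} =
      (if n = 2 then {(2, 1, 1, 1), (4, 3, 2, 1), (6, 1, 3, 3)}
       else if n = 3 then {(3, 2, 2, 2)}
       else {}))"
proof (intro conjI impI)
  assume "[n = 4] (mod 16) \<or> [n = 8] (mod 16) \<or> [n = 1] (mod 8) \<or> [n = 2] (mod 8)"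
  then have n: "n mod 16 = 4 \<or> n mod 16 = 8 \<or> n mod 8 = 1 \<or> n mod 8 = 2"
    by (simp add: cong_def)
  show "\<not> (\<exists>(x::nat) (y::nat) (z::nat) (w::nat). x > 0 \<and> y > 0 \<and> z > 0 \<and> w > 0 \<and>
          n ^ x + (n + 1) ^ y + (n + 2) ^ z = (n + 3) ^ w)"
  proof clarify
    fix x y z w :: nat
    assume pos: "x > 0" "y > 0" "z > 0" "w > 0"
      and eq: "n ^ x + (n + 1) ^ y + (n + 2) ^ z = (n + 3) ^ w"
    have "n = 2" using equation_i_forces_2[OF \<open>n > 1\<close> pos n eq] .
    with eq no_solution_2_3_4_to_5[OF pos] show False by simp
  qed
next
  assume "[n = 4] (mod 8) \<or> [n = 1] (mod 4) \<or> [n = 2] (mod 8) \<or> [n = 3] (mod 8)"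
  then have n: "n mod 8 = 4 \<or> n mod 4 = 1 \<or> n mod 8 = 2 \<or> n mod 8 = 3"
    by (simp add: cong_def)
  show "{(x::nat, y::nat, z::nat, w::nat). x > 0 \<and> y > 0 \<and> z > 0 \<and> w > 0 \<and>
          n ^ x + (n + 1) ^ y = (n + 2) ^ z + (n + 3) ^ w} =
      (if n = 2 then {(1, 3, 1, 2), (3, 4, 3, 2), (5, 2, 2, 2)}
       else if n = 3 then {(3, 1, 2, 1)}
       else {})"
  proof (rule solution_set_eqI)
    fix x y z w :: nat
    assume pos: "x > 0" "y > 0" "z > 0" "w > 0"
      and eq: "n ^ x + (n + 1) ^ y = (n + 2) ^ z + (n + 3) ^ w"
    from equation_ii_forces_2_or_3[OF \<open>n > 1\<close> pos n eq]
    show "(x, y, z, w) \<in> (if n = 2 then {(1, 3, 1, 2), (3, 4, 3, 2), (5, 2, 2, 2)}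
       else if n = 3 then {(3, 1, 2, 1)} else {})"
      using eq solutions_2_3_to_4_5[OF pos] solutions_3_4_to_5_6[OF pos] by auto
  qed (auto split: if_splits)
next
  assume "[n = 8] (mod 16) \<or> [n = 12] (mod 16) \<or> [n = 5] (mod 8) \<or> [n = 2] (mod 4) \<or> [n = 3] (mod 8)"
  then have n: "n mod 16 = 8 \<or> n mod 16 = 12 \<or> n mod 8 = 5 \<or> n mod 4 = 2 \<or> n mod 8 = 3"
    by (simp add: cong_def)
  show "{(x::nat, y::nat, z::nat, w::nat). x > 0 \<and> y > 0 \<and> z > 0 \<and> w > 0 \<and>
          n ^ x + (n + 2) ^ z + (n + 3) ^ w = (n + 1) ^ y} =
      (if n = 3 then {(1, 3, 2, 2)} else {})"
  proof (rule solution_set_eqI)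
    fix x y z w :: nat
    assume pos: "x > 0" "y > 0" "z > 0" "w > 0"
      and eq: "n ^ x + (n + 2) ^ z + (n + 3) ^ w = (n + 1) ^ y"
    from equation_iii_forces_2_or_3[OF \<open>n > 1\<close> pos n eq]
    show "(x, y, z, w) \<in> (if n = 3 then {(1, 3, 2, 2)} else {})"
      using eq no_solution_2_4_5_to_3[OF pos] solutions_3_5_6_to_4[OF pos] by auto
  qed (auto split: if_splits)
next
  assume "[n = 4] (mod 16) \<or> [n = 8] (mod 16) \<or> [n = 1] (mod 8) \<or> [n = 2] (mod 8) \<or> [n = 3] (mod 8)"
  then have n: "n mod 16 = 4 \<or> n mod 16 = 8 \<or> n mod 8 = 1 \<or> n mod 8 = 2 \<or> n mod 8 = 3"
    by (simp add: cong_def)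
  show "{(x::nat, y::nat, z::nat, w::nat). x > 0 \<and> y > 0 \<and> z > 0 \<and> w > 0 \<and>
          n ^ x + (n + 2) ^ z = (n + 1) ^ y + (n + 3) ^ w} =
      (if n = 2 then {(2, 1, 1, 1), (4, 3, 2, 1), (6, 1, 3, 3)}
       else if n = 3 then {(3, 2, 2, 2)}
       else {})"
  proof (rule solution_set_eqI)
    fix x y z w :: nat
    assume pos: "x > 0" "y > 0" "z > 0" "w > 0"
      and eq: "n ^ x + (n + 2) ^ z = (n + 1) ^ y + (n + 3) ^ w"
    from equation_iv_forces_2_or_3[OF \<open>n > 1\<close> pos n eq]
    show "(x, y, z, w) \<in> (if n = 2 then {(2, 1, 1, 1), (4, 3, 2, 1), (6, 1, 3, 3)}
       else if n = 3 then {(3, 2, 2, 2)} else {})"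
      using eq solutions_2_4_to_3_5[OF pos] solutions_3_5_to_4_6[OF pos] by auto
  qed (auto split: if_splits)
qed

end
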